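(* Let $P_n(x_1,\ldots,x_n)$, $n\ge0$, be the Kailath–Segall polynomials, given by $P_0=1$ and, for $n\ge1$, the recurrence $$P_n(x_1,\ldots,x_n)=\frac1n\Big(P_{n-1}(x_1,\ldots,x_{n-1})\,x_1-P_{n-2}(x_1,\ldots,x_{n-2})\,x_2+\cdots+(-1)^{n+1}P_0\,x_n\Big).$$ Then, for every $n\ge1$, $$P_n(x_1,\ldots,x_n)=\frac{1}{n!}\,\Gamma_n\big(x_1,\,-x_2,\,2!\,x_3,\,\ldots,\,(-1)^{n-1}(n-1)!\,x_n\big),$$ where the $k$-th argument of $\Gamma_n$ is $(-1)^{k-1}(k-1)!\,x_k$ and $\Gamma_n$ is the polynomial expressing the $n$-th moment in terms of the first $n$ cumulants (defined explicitly in the context).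
   Context: Polynomials $\Gamma_n$: $\Gamma_0=1$ and, for $n\ge 1$, $$\Gamma_n(x_1,\ldots,x_n)=n!\sum \frac{x_1^{r_1}}{(1!)^{r_1}r_1!}\cdots\frac{x_n^{r_n}}{(n!)^{r_n}r_n!},$$ where the sum is over all non-negative integers $r_1,\ldots,r_n$ such that $\sum_{j=1}^n j r_j=n$. Equivalently, as formal power series in $u$, $\exp\{\sum_{n\ge1}x_n u^n/n!\}=\sum_{n\ge0}\Gamma_n(x_1,\ldots,x_n)u^n/n!$. Origin of the polynomials $P_n$: for a centered Lévy process $X$ with moments of all orders, define the iterated integrals $P^{(0)}_t=1$, $P^{(1)}_t=X_t$, $P^{(n)}_t=\int_0^t P^{(n-1)}_{s-}\,dX_s$, and the variations $X^{(1)}_t=X_t$, $X^{(2)}_t=[X,X]_t$, $X^{(n)}_t=\sum_{s\le t}(\Delta X_s)^n$ for $n\ge3$. The Kailath–Segall formula $P^{(n)}_t=\frac1n\big(P^{(n-1)}_tX^{(1)}_t-P^{(n-2)}_tX^{(2)}_t+\cdots+(-1)^{n+1}P^{(0)}_tX^{(n)}_t\big)$ shows that $P_t^{(n)}=P_n(X^{(1)}_t,\ldots,X^{(n)}_t)$, with $P_n$ the polynomials given by the recurrence in the claim. *)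

theory Defs
  imports Complex_Main "HOL-Library.FuncSet"
begin

text \<open>
  A polynomial in \<open>x\<^sub>1, \<dots>, x\<^sub>n\<close> with rational coefficients is represented by its evaluation at a
  sequence \<open>x :: nat \<Rightarrow> 'a\<close> over an arbitrary field of characteristic 0. The variables are
  indexed from 1, so \<open>x 0\<close> and the \<open>x k\<close> with \<open>k > n\<close> play no role. As \<open>'a\<close> may be the field of
  rational functions, an identity valid for all \<open>'a\<close> and \<open>x\<close> is an identity of formal
  polynomials.
\<close>

definition gamma_exponents :: "nat \<Rightarrow> (nat \<Rightarrow> nat) set" where
  "gamma_exponents n = {r \<in> {1..n} \<rightarrow>\<^sub>E UNIV. (\<Sum>j=1..n. j * r j) = n}"

definition Gamma_poly :: "nat \<Rightarrow> (nat \<Rightarrow> 'a :: field_char_0) \<Rightarrow> 'a" where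
  "Gamma_poly n x =
     fact n * (\<Sum>r\<in>gamma_exponents n. \<Prod>j=1..n. x j ^ r j / (fact j ^ r j * fact (r j)))"

function KS_poly :: "nat \<Rightarrow> (nat \<Rightarrow> 'a :: field_char_0) \<Rightarrow> 'a" where
  "KS_poly n x =
     (if n = 0 then 1
      else 1 / of_nat n * (\<Sum>k=1..n. (-1) ^ (k + 1) * KS_poly (n - k) x * x k))"
  by auto
termination
  by (relation "measure fst") auto

declare KS_poly.simps [simp del]

text \<open>The sum defining \<^const>\<open>Gamma_poly\<close> is over a finite set, so it is not a default value.\<close>

lemma finite_gamma_exponents: "finite (gamma_exponents n)"
proof (rule finite_subset)
  show "gamma_exponents n \<subseteq> {1..n} \<rightarrow>\<^sub>E {0..n}"
  proof
    fix r assume r: "r \<in> gamma_exponents n"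
    have "r j \<le> n" if j: "j \<in> {1..n}" for j
    proof -
      have "j * r j \<le> (\<Sum>j=1..n. j * r j)"
        using j by (intro member_le_sum) auto
      moreover have "r j \<le> j * r j"
        using j by simp
      moreover have "(\<Sum>j=1..n. j * r j) = n"
        using r by (simp add: gamma_exponents_def)
      ultimately show ?thesis
        by linarith
    qed
    then show "r \<in> {1..n} \<rightarrow>\<^sub>E {0..n}"
      using r by (auto simp: gamma_exponents_def PiE_iff)
  qed
  show "finite ({1..n} \<rightarrow>\<^sub>E {0..n})"
    by (intro finite_PiE) auto
qed

lemma Gamma_poly_0: "Gamma_poly 0 x = 1"
proof -
  have "gamma_exponents 0 = {\<lambda>_. undefined}"
    by (auto simp: gamma_exponents_def)
  then show ?thesis
    by (simp add: Gamma_poly_def)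
qed

end

theory Submission imports Defs begin

text \<open>
  Put \<open>z\<^sub>j = y\<^sub>j / j!\<close>, so that \<open>\<Gamma>\<^sub>n(y) / n!\<close> is the sum of the weights
  \<open>\<Prod>\<^sub>j z\<^sub>j\<^bsup>r\<^sub>j\<^esup> / r\<^sub>j!\<close> over all \<open>r\<close> with \<open>\<Sum>\<^sub>j j r\<^sub>j = n\<close>. Multiply by \<open>n = \<Sum>\<^sub>k k r\<^sub>k\<close> and
  exchange the sums: the factor \<open>r\<^sub>k\<close> turns the weight of \<open>r\<close> into \<open>z\<^sub>k\<close> times the weight of \<open>r\<close>
  with \<open>r\<^sub>k\<close> lowered by one, an exponent vector of total \<open>n - k\<close>. For
  \<open>y\<^sub>k = (-1)\<^bsup>k-1\<^esup> (k-1)! x\<^sub>k\<close> one has \<open>k z\<^sub>k = (-1)\<^bsup>k-1\<^esup> x\<^sub>k\<close>, and the resulting recurrence is that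
  of the Kailath--Segall polynomials.
\<close>

text \<open>The number of variables is decoupled from the total because lowering one exponent of a
  vector on \<open>{1..n}\<close> changes the total but keeps the index set.\<close>

definition exponents_upto :: "nat \<Rightarrow> nat \<Rightarrow> (nat \<Rightarrow> nat) set" where
  "exponents_upto m n = {r \<in> {1..m} \<rightarrow>\<^sub>E UNIV. (\<Sum>j=1..m. j * r j) = n}"

definition exponent_weight :: "nat \<Rightarrow> (nat \<Rightarrow> 'a :: field_char_0) \<Rightarrow> (nat \<Rightarrow> nat) \<Rightarrow> 'a" where
  "exponent_weight m z r = (\<Prod>j=1..m. z j ^ r j / fact (r j))"

lemma exponents_upto_self: "exponents_upto n n = gamma_exponents n"
  by (simp add: exponents_upto_def gamma_exponents_def)

lemma Gamma_poly_eq_sum_weight: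
  "Gamma_poly n y = fact n * (\<Sum>r\<in>gamma_exponents n. exponent_weight n (\<lambda>j. y j / fact j) r)"
  by (simp add: Gamma_poly_def exponent_weight_def power_divide)

lemma exponents_upto_eq_0:
  assumes "r \<in> exponents_upto m n" "j \<in> {1..m}" "n < j"
  shows "r j = 0"
proof (rule ccontr)
  assume "r j \<noteq> 0"
  have "j * r j \<le> (\<Sum>j=1..m. j * r j)"
    using assms(2) by (intro member_le_sum) auto
  also have "\<dots> = n"
    using assms(1) by (simp add: exponents_upto_def)
  finally have "j * r j \<le> n" .
  moreover have "j \<le> j * r j"
    using \<open>r j \<noteq> 0\<close> by simp
  ultimately show False
    using \<open>n < j\<close> by linarith
qed

text \<open>Exponents at indices above \<open>n\<close> must vanish, and each contributes a factor
  \<open>z j ^ 0 / fact 0 = 1\<close>. Padding with zeros is therefore a weight-preserving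
  bijection.\<close>

lemma sum_weight_exponents_upto:
  assumes "n \<le> m"
  shows "(\<Sum>r\<in>exponents_upto m n. exponent_weight m z r) =
         (\<Sum>r\<in>gamma_exponents n. exponent_weight n z r)"
proof -
  \<comment> \<open>The value \<open>undefined\<close> outside \<open>{1..m}\<close> keeps the
    padded vector extensional.\<close>
  define ext where "ext s = (\<lambda>j. if j \<in> {1..n} then s j else if j \<in> {1..m} then 0 else undefined)"
    for s :: "nat \<Rightarrow> nat"
  have sub: "{1..n} \<subseteq> {1..m}"
    using assms by auto
  have zero: "r j = 0" if "r \<in> exponents_upto m n" "j \<in> {1..m} - {1..n}" for r j
    using exponents_upto_eq_0[OF that(1), of j] that(2) by auto
  have total: "(\<Sum>j=1..m. j * r j) = (\<Sum>j=1..n. j * r j)"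
    if "\<And>j. j \<in> {1..m} - {1..n} \<Longrightarrow> r j = 0" for r :: "nat \<Rightarrow> nat"
    using that by (intro sum.mono_neutral_right sub) auto
  show ?thesis
    unfolding exponents_upto_self[symmetric]
  proof (rule sum.reindex_bij_witness[of _ ext "\<lambda>r. restrict r {1..n}"])
    fix r assume r: "r \<in> exponents_upto m n"
    show "ext (restrict r {1..n}) = r"
      using zero[OF r] r by (fastforce simp: ext_def exponents_upto_def PiE_iff extensional_def)
    show "restrict r {1..n} \<in> exponents_upto n n"
      using total[OF zero[OF r]] r by (simp add: exponents_upto_def)
    show "exponent_weight n z (restrict r {1..n}) = exponent_weight m z r"
      unfolding exponent_weight_def
      by (rule prod.mono_neutral_cong_left) (use sub zero[OF r] in auto)
  next
    fix s assume s: "s \<in> exponents_upto n n"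
    show "restrict (ext s) {1..n} = s"
      using s by (auto simp: ext_def exponents_upto_def PiE_iff extensional_def fun_eq_iff)
    have "(\<Sum>j=1..m. j * ext s j) = (\<Sum>j=1..n. j * ext s j)"
      by (rule total) (auto simp: ext_def)
    also have "\<dots> = n"
      using s by (simp add: ext_def exponents_upto_def)
    finally show "ext s \<in> exponents_upto m n"
      using assms by (auto simp: ext_def exponents_upto_def PiE_iff extensional_def)
  qed
qed

text \<open>Only the \<open>k\<close>-th factor changes, and there (a+1) / (a+1)! = 1 / a! with a =
  \<open>s k\<close>.\<close>

lemma exponent_weight_incr:
  assumes "k \<in> {1..m}"
  shows "of_nat (Suc (s k)) * exponent_weight m z (s(k := Suc (s k))) = z k * exponent_weight m z s"
proof -
  have "(\<Prod>j\<in>{1..m} - {k}. z j ^ (s(k := Suc (s k))) j / fact ((s(k := Suc (s k))) j)) =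
        (\<Prod>j\<in>{1..m} - {k}. z j ^ s j / fact (s j))"
    by (rule prod.cong) auto
  then show ?thesis
    using assms of_nat_neq_0[of "s k", where ?'a = 'a]
    by (simp add: exponent_weight_def prod.remove[of _ k] fact_Suc divide_simps
        del: of_nat_Suc)
qed

lemma sum_mult_exponent_weight:
  assumes "k \<in> {1..n}"
  shows "(\<Sum>r\<in>gamma_exponents n. of_nat (r k) * exponent_weight n z r) =
         z k * (\<Sum>s\<in>exponents_upto n (n - k). exponent_weight n z s)"
proof -
  have total: "(\<Sum>j=1..n. j * (s(k := Suc (s k))) j) = k + (\<Sum>j=1..n. j * s j)" for s
  proof -
    have "(\<Sum>j\<in>{1..n} - {k}. j * (s(k := Suc (s k))) j) = (\<Sum>j\<in>{1..n} - {k}. j * s j)"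
      by (rule sum.cong) auto
    then show ?thesis
      using assms by (simp add: sum.remove[of _ k])
  qed
  \<comment> \<open>Vectors with \<open>r k = 0\<close> contribute nothing. They are discarded
    first, since truncated subtraction makes \<open>r k - 1\<close> invertible only for positive
    \<open>r k\<close>.\<close>
  have "(\<Sum>r\<in>gamma_exponents n. of_nat (r k) * exponent_weight n z r) =
        (\<Sum>r | r \<in> gamma_exponents n \<and> r k \<noteq> 0. of_nat (r k) * exponent_weight n z r)"
    by (rule sum.mono_neutral_right) (auto simp: finite_gamma_exponents)
  also have "\<dots> = (\<Sum>s\<in>exponents_upto n (n - k). z k * exponent_weight n z s)"
  proof (rule sum.reindex_bij_witness[of _ "\<lambda>s. s(k := Suc (s k))" "\<lambda>r. r(k := r k - 1)"])
    fix r assume r: "r \<in> {r \<in> gamma_exponents n. r k \<noteq> 0}"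
    define s where "s = r(k := r k - 1)"
    have r_eq: "r = s(k := Suc (s k))"
      using r by (auto simp: s_def fun_eq_iff)
    then show "(r(k := r k - 1))(k := Suc ((r(k := r k - 1)) k)) = r"
      by (simp add: s_def)
    show "z k * exponent_weight n z (r(k := r k - 1)) = of_nat (r k) * exponent_weight n z r"
      using exponent_weight_incr[OF assms, of s z] r r_eq by (metis fun_upd_same s_def)
    have "k + (\<Sum>j=1..n. j * s j) = n"
      using r total[of s] by (simp add: r_eq[symmetric] gamma_exponents_def)
    then show "r(k := r k - 1) \<in> exponents_upto n (n - k)"
      using r assms unfolding s_def[symmetric]
      by (auto simp: exponents_upto_def gamma_exponents_def PiE_iff extensional_def s_def)
  next
    fix s assume s: "s \<in> exponents_upto n (n - k)"
    show "(s(k := Suc (s k)))(k := (s(k := Suc (s k))) k - 1) = s"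
      by simp
    show "s(k := Suc (s k)) \<in> {r \<in> gamma_exponents n. r k \<noteq> 0}"
      using s total[of s] assms
      by (auto simp: exponents_upto_def gamma_exponents_def PiE_iff extensional_def)
  qed
  finally show ?thesis
    by (simp add: sum_distrib_left)
qed

text \<open>This is the coefficient form of u F'(u) = u g'(u) F(u) for F = exp g, where g(u) is the
  sum of the \<open>z k\<close> u^k.\<close>

lemma sum_exponent_weight_recurrence:
  fixes z :: "nat \<Rightarrow> 'a :: field_char_0"
  shows "of_nat n * (\<Sum>r\<in>gamma_exponents n. exponent_weight n z r) =
         (\<Sum>k=1..n. of_nat k * z k * (\<Sum>r\<in>gamma_exponents (n - k). exponent_weight (n - k) z r))"
proof -
  have "of_nat n * (\<Sum>r\<in>gamma_exponents n. exponent_weight n z r) =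
        (\<Sum>r\<in>gamma_exponents n. \<Sum>k=1..n. of_nat k * (of_nat (r k) * exponent_weight n z r))"
    unfolding sum_distrib_left
  proof (rule sum.cong)
    fix r assume "r \<in> gamma_exponents n"
    then have "of_nat n = (of_nat (\<Sum>k=1..n. k * r k) :: 'a)"
      by (simp add: gamma_exponents_def)
    then show "of_nat n * exponent_weight n z r =
               (\<Sum>k=1..n. of_nat k * (of_nat (r k) * exponent_weight n z r))"
      by (simp add: sum_distrib_right mult.assoc)
  qed simp
  also have "\<dots> = (\<Sum>k=1..n. of_nat k * (\<Sum>r\<in>gamma_exponents n. of_nat (r k) * exponent_weight n z r))"
    by (subst sum.swap) (simp add: sum_distrib_left)
  also have "\<dots> = (\<Sum>k=1..n. of_nat k * z k *
                     (\<Sum>r\<in>gamma_exponents (n - k). exponent_weight (n - k) z r))"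
    by (rule sum.cong) (simp_all add: sum_mult_exponent_weight sum_weight_exponents_upto mult.assoc)
  finally show ?thesis .
qed

text \<open>For positive \<open>n\<close>, multiplying by (n-1)! gives the usual moment-cumulant
  recurrence with coefficients binom(n-1, k-1).\<close>

lemma Gamma_poly_recurrence:
  fixes y :: "nat \<Rightarrow> 'a :: field_char_0"
  shows "of_nat n * (Gamma_poly n y / fact n) =
         (\<Sum>k=1..n. y k / fact (k - 1) * (Gamma_poly (n - k) y / fact (n - k)))"
proof -
  have "of_nat k * (y k / fact k) = y k / fact (k - 1)" if "k \<in> {1..n}" for k
    using that fact_reduce[of k, where ?'a = 'a] by (simp add: divide_simps)
  then show ?thesis
    using sum_exponent_weight_recurrence[of n "\<lambda>j. y j / fact j"]
    by (simp add: Gamma_poly_eq_sum_weight)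
qed

text \<open>The factor \<open>fact (k - 1)\<close> in \<open>y k\<close> cancels the denominator in
  \<open>Gamma_poly_recurrence\<close>, leaving the defining recurrence of \<open>KS_poly\<close>;
  strong induction then applies.\<close>

lemma KS_poly_eq_Gamma_poly:
  fixes x :: "nat \<Rightarrow> 'a :: field_char_0"
  defines "y \<equiv> (\<lambda>k. (-1) ^ (k - 1) * fact (k - 1) * x k)"
  shows "KS_poly n x = Gamma_poly n y / fact n"
proof (induction n rule: less_induct)
  case (less n)
  show ?case
  proof (cases "n = 0")
    case True
    then show ?thesis
      by (simp add: KS_poly.simps Gamma_poly_0)
  next
    case False
    have "(-1) ^ (k + 1) * KS_poly (n - k) x * x k =
          y k / fact (k - 1) * (Gamma_poly (n - k) y / fact (n - k))" if k: "k \<in> {1..n}" for k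
    proof -
      \<comment> \<open>The exponents differ by two; this needs \<open>k\<close> positive, as
        \<open>k - 1\<close> is truncated at 0.\<close>
      have "(-1) ^ (k + 1) = ((-1) ^ (k - 1) :: 'a)"
        using k by (cases k) auto
      then show ?thesis
        using k less.IH[of "n - k"] by (simp add: y_def)
    qed
    then have "KS_poly n x = 1 / of_nat n * (of_nat n * (Gamma_poly n y / fact n))"
      unfolding Gamma_poly_recurrence using False by (simp add: KS_poly.simps[of n])
    then show ?thesis
      using False by simp
  qed
qed

theorem mainTheorem3:
  fixes x :: "nat \<Rightarrow> 'a :: field_char_0" and n :: nat
  assumes "n \<ge> 1"
  shows "KS_poly n x = 1 / fact n * Gamma_poly n (\<lambda>k. (-1) ^ (k - 1) * fact (k - 1) * x k)"
  by (simp add: KS_poly_eq_Gamma_poly)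

end
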